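(* For each $n\geq1$ and every $k$, the number of linear extensions $w$ of $\varepsilon Z_n$ with $\mathrm{des}(w)=k$ equals the number of $u\in U_n$ with $\mathrm{ret}_1(u)=k$; equivalently \[ Z_n(t)=\sum_{w\in\mathcal{L}(\varepsilon Z_n)}t^{1+\mathrm{des}(w)}=\sum_{u\in U_n}t^{1+\mathrm{ret}_1(u)}. \]
   Context: The zig-zag poset $Z_n$ on $[n]$ is generated by $j<j+1$ for odd $j\in[n-1]$ and $j>j+1$ for even $j$. $\varepsilon\in S_n$ is the involution swapping $2i$ and $2i+1$ for every $i\ge1$ with $2i+1\leq n$, and $\varepsilon Z_n$ is the poset with $\varepsilon(i)<\varepsilon(j)$ iff $i<_{Z_n}j$. $\mathcal{L}(P)$ is the set of $\pi\in S_n$ with $\pi^{-1}(i)<\pi^{-1}(j)$ whenever $i<_Pj$. $\mathrm{des}(w)=|\{i\in[n-1]:w(i)>w(i+1)\}|$. $U_n$ is the set of up-down alternating permutations $u\in S_n$ ($u(1)<u(2)>u(3)<\cdots$). For $u\in S_n$, $\mathrm{ret}_1(u)=|\{i\in[n-1]:u^{-1}(i)>u^{-1}(i+1)+1\}|$ (number of big returns). *)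

theory Defs
  imports "HOL-Combinatorics.Permutations" "HOL-Computational_Algebra.Polynomial"
begin

text \<open>
  Permutations in \<open>S\<^sub>n\<close> are functions \<open>w :: nat \<Rightarrow> nat\<close> with \<open>w permutes {1..n}\<close>; a poset on
  \<open>[n]\<close> is represented by its strict order relation.
\<close>

definition zigzag_gen :: "nat \<Rightarrow> nat rel" where
  "zigzag_gen n =
     {(j, j + 1) | j. j \<in> {1..<n} \<and> odd j} \<union> {(j + 1, j) | j. j \<in> {1..<n} \<and> even j}"

definition zigzag :: "nat \<Rightarrow> nat rel" where
  "zigzag n = (zigzag_gen n)\<^sup>+"

definition eps :: "nat \<Rightarrow> nat \<Rightarrow> nat" where
  "eps n j =
     (if even j \<and> 2 \<le> j \<and> j + 1 \<le> n then j + 1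
      else if odd j \<and> 3 \<le> j \<and> j \<le> n then j - 1
      else j)"

lemma eps_swaps:
  assumes "1 \<le> i" "2 * i + 1 \<le> n"
  shows "eps n (2 * i) = 2 * i + 1" "eps n (2 * i + 1) = 2 * i"
  using assms by (auto simp: eps_def)

lemma eps_involution: "eps n (eps n j) = j"
  by (auto simp: eps_def)

lemma eps_permutes: "eps n permutes {1..n}"
  unfolding permutes_def
proof (intro conjI allI impI)
  fix x assume "x \<notin> {1..n}"
  then show "eps n x = x" by (auto simp: eps_def)
next
  fix y show "\<exists>!x. eps n x = y" by (metis eps_involution)
qed

definition relabel :: "(nat \<Rightarrow> nat) \<Rightarrow> nat rel \<Rightarrow> nat rel" where
  "relabel f P = {(f i, f j) | i j. (i, j) \<in> P}"

definition linear_extensions :: "nat \<Rightarrow> nat rel \<Rightarrow> (nat \<Rightarrow> nat) set" where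
  "linear_extensions n P =
     {w. w permutes {1..n} \<and> (\<forall>i j. (i, j) \<in> P \<longrightarrow> inv w i < inv w j)}"

definition des :: "nat \<Rightarrow> (nat \<Rightarrow> nat) \<Rightarrow> nat" where
  "des n w = card {i \<in> {1..<n}. w i > w (i + 1)}"

definition up_down :: "nat \<Rightarrow> (nat \<Rightarrow> nat) set" where
  "up_down n =
     {u. u permutes {1..n} \<and>
         (\<forall>i\<in>{1..<n}. if odd i then u i < u (i + 1) else u i > u (i + 1))}"

definition big_returns :: "nat \<Rightarrow> (nat \<Rightarrow> nat) \<Rightarrow> nat" where
  "big_returns n u = card {i \<in> {1..<n}. inv u i > inv u (i + 1) + 1}"

definition zigzag_eulerian :: "nat \<Rightarrow> int poly" where
  "zigzag_eulerian n =
     (\<Sum>w\<in>linear_extensions n (relabel (eps n) (zigzag n)). monom 1 (1 + des n w))"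

end

theory Submission imports Defs begin

text \<open>
  The map \<open>u \<mapsto> \<epsilon> \<circ> u\<^sup>-\<^sup>1\<close> is a bijection from up-down permutations onto linear extensions of
  \<open>\<epsilon>Z\<^sub>n\<close>, and it turns big returns into descents position by position: \<open>\<epsilon>\<close> only reverses the
  order of the adjacent pairs \<open>2i, 2i + 1\<close>, and if \<open>m\<close> and \<open>m + 1\<close> sit in adjacent positions of
  an up-down permutation, then the parity of these positions forces the order of \<open>m\<close> and
  \<open>m + 1\<close>, so that no descent arises.
\<close>

text \<open>Strict inequalities along generating pairs chain by transitivity, so
  \<open>zigzag n\<close> can be tested on its generators, where its constraints are the alternating
  inequalities.\<close>

lemma trancl_increasing_iff:
  fixes u :: "'a \<Rightarrow> 'b :: order"
  shows "(\<forall>i j. (i, j) \<in> R\<^sup>+ \<longrightarrow> u i < u j) \<longleftrightarrow> (\<forall>i j. (i, j) \<in> R \<longrightarrow> u i < u j)"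
proof (intro iffI allI impI)
  fix i j
  assume step: "\<forall>i j. (i, j) \<in> R \<longrightarrow> u i < u j" and "(i, j) \<in> R\<^sup>+"
  from this(2) show "u i < u j"
    by induction (use step in \<open>auto intro: less_trans\<close>)
qed auto

lemma up_down_iff_zigzag:
  "u \<in> up_down n \<longleftrightarrow> u permutes {1..n} \<and> (\<forall>i j. (i, j) \<in> zigzag n \<longrightarrow> u i < u j)"
  unfolding zigzag_def trancl_increasing_iff up_down_def zigzag_gen_def by auto

lemma inv_eps: "inv (eps n) = eps n"
  by (intro inv_unique_comp) (auto simp: eps_involution)

lemma inv_eps_comp_inv:
  assumes "u permutes {1..n}"
  shows "inv (eps n \<circ> inv u) = u \<circ> eps n"
proof -
  have "inv (eps n \<circ> inv u) = inv (inv u) \<circ> inv (eps n)"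
    by (intro o_inv_distrib permutes_bij[OF eps_permutes] permutes_bij[OF permutes_inv[OF assms]])
  then show ?thesis
    by (simp add: inv_eps permutes_inv_inv[OF assms])
qed

text \<open>The inverse of \<open>eps n \<circ> inv u\<close> is \<open>u \<circ> eps n\<close>, and
  the relabelled constraints compare its values at \<open>eps n i\<close> and
  \<open>eps n j\<close>. The two copies of \<open>eps n\<close> cancel, leaving
  \<open>u i < u j\<close> on \<open>zigzag n\<close>.\<close>

lemma linear_extensions_relabel_eps_iff:
  assumes "u permutes {1..n}"
  shows "eps n \<circ> inv u \<in> linear_extensions n (relabel (eps n) (zigzag n)) \<longleftrightarrow> u \<in> up_down n"
proof -
  have "eps n \<circ> inv u permutes {1..n}"
    by (intro permutes_compose permutes_inv assms eps_permutes)
  moreover have "(\<forall>i j. (i, j) \<in> relabel (eps n) (zigzag n) \<longrightarrow> P i j) \<longleftrightarrow>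
      (\<forall>i j. (i, j) \<in> zigzag n \<longrightarrow> P (eps n i) (eps n j))" for P
    unfolding relabel_def by blast
  ultimately show ?thesis
    using assms
    by (simp add: linear_extensions_def inv_eps_comp_inv eps_involution up_down_iff_zigzag)
qed

lemma bij_betw_up_down_linear_extensions:
  "bij_betw (\<lambda>u. eps n \<circ> inv u) (up_down n)
     (linear_extensions n (relabel (eps n) (zigzag n)))"
\<comment> \<open>Solving \<open>w = eps n \<circ> inv u\<close> for \<open>u\<close>, with
  \<open>eps n\<close> its own inverse, gives this witness.\<close>
proof (rule bij_betw_byWitness[where f' = "\<lambda>w. inv w \<circ> eps n"])
  have involution: "eps n \<circ> eps n = id"
    by (auto simp: eps_involution)
  have recover: "eps n \<circ> inv (inv w \<circ> eps n) = w" if "w permutes {1..n}" for w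
  proof -
    have "inv (inv w \<circ> eps n) = inv (eps n) \<circ> inv (inv w)"
      by (intro o_inv_distrib permutes_bij[OF eps_permutes] permutes_bij[OF permutes_inv[OF that]])
    then show ?thesis
      by (simp add: inv_eps permutes_inv_inv[OF that] o_assoc involution)
  qed
  show "\<forall>u\<in>up_down n. inv (eps n \<circ> inv u) \<circ> eps n = u"
    by (auto simp: up_down_def inv_eps_comp_inv eps_involution fun_eq_iff)
  show "\<forall>w\<in>linear_extensions n (relabel (eps n) (zigzag n)). eps n \<circ> inv (inv w \<circ> eps n) = w"
    by (auto simp: linear_extensions_def recover)
  show "(\<lambda>u. eps n \<circ> inv u) ` up_down n \<subseteq> linear_extensions n (relabel (eps n) (zigzag n))"
    using linear_extensions_relabel_eps_iff by (auto simp: up_down_def)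
  show "(\<lambda>w. inv w \<circ> eps n) ` linear_extensions n (relabel (eps n) (zigzag n)) \<subseteq> up_down n"
  proof (rule image_subsetI)
    fix w
    assume w: "w \<in> linear_extensions n (relabel (eps n) (zigzag n))"
    then have perm: "w permutes {1..n}"
      by (simp add: linear_extensions_def)
    have "inv w \<circ> eps n permutes {1..n}"
      by (intro permutes_compose permutes_inv perm eps_permutes)
    \<comment> \<open>The equivalence is read backwards: by \<open>recover\<close>, the permutation
      it tests is \<open>w\<close> itself.\<close>
    from linear_extensions_relabel_eps_iff[OF this] show "inv w \<circ> eps n \<in> up_down n"
      using w by (simp add: recover[OF perm])
  qed
qed

text \<open>For neighbours the parity hypotheses make both sides false: with
  \<open>p = q + 1\<close> and \<open>q\<close> even, \<open>eps n\<close> swaps the two; with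
  \<open>q = p + 1\<close> and \<open>p\<close> odd, it never moves them towards each other.\<close>

lemma eps_less_iff:
  assumes "p \<in> {1..n}" "q \<in> {1..n}" "p \<noteq> q"
    and "p = q + 1 \<Longrightarrow> even q" and "q = p + 1 \<Longrightarrow> odd p"
  shows "eps n q < eps n p \<longleftrightarrow> q + 1 < p"
proof -
  consider "p = q + 1" | "q = p + 1" | "q + 1 < p" | "p + 1 < q"
    using assms(3) by linarith
  then show ?thesis
  proof cases
    case 3
    \<comment> \<open>\<open>eps n\<close> moves a point by at most one, so a gap above two keeps
      its order. At gap two the parities agree, so the points cannot move towards each
      other.\<close>
    then have "q + 2 < p \<or> p = q + 2" by linarith
    with 3 assms show ?thesis
      unfolding eps_def by (elim disjE) auto
  next
    case 4
    then have "p + 2 < q \<or> q = p + 2" by linarith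
    with 4 assms show ?thesis
      unfolding eps_def by (elim disjE) auto
  qed (use assms in \<open>auto simp: eps_def\<close>)
qed

lemma des_eps_comp_inv:
  assumes "u \<in> up_down n"
  shows "des n (eps n \<circ> inv u) = big_returns n u"
proof -
  from assms have perm: "u permutes {1..n}"
    and alt: "\<And>i. i \<in> {1..<n} \<Longrightarrow> if odd i then u i < u (i + 1) else u i > u (i + 1)"
    unfolding up_down_def by blast+
  have "eps n (inv u (i + 1)) < eps n (inv u i) \<longleftrightarrow> inv u (i + 1) + 1 < inv u i"
    if i: "i \<in> {1..<n}" for i
  proof (rule eps_less_iff)
    let ?p = "inv u i" and ?q = "inv u (i + 1)"
    show p: "?p \<in> {1..n}" and q: "?q \<in> {1..n}"
      using i permutes_in_image[OF permutes_inv[OF perm]] by auto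
    have up: "u ?p = i" and uq: "u ?q = i + 1"
      using permutes_inverses(1)[OF perm] by auto
    then show "?p \<noteq> ?q"
      by (metis n_not_Suc_n Suc_eq_plus1)
    \<comment> \<open>Here \<open>u\<close> takes the values \<open>i + 1\<close>, \<open>i\<close>
      at \<open>?q\<close>, \<open>?q + 1\<close>: a descent, so its position is even. The other
      case is an ascent.\<close>
    show "even ?q" if "?p = ?q + 1"
      using alt[of ?q] p q up uq that by (auto split: if_splits)
    show "odd ?p" if "?q = ?p + 1"
      using alt[of ?p] p q up uq that by (auto split: if_splits)
  qed
  then have "{i \<in> {1..<n}. (eps n \<circ> inv u) (i + 1) < (eps n \<circ> inv u) i}
      = {i \<in> {1..<n}. inv u (i + 1) + 1 < inv u i}"
    by auto
  then show ?thesis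
    by (simp only: des_def big_returns_def)
qed

theorem theorem3p2:
  fixes n :: nat
  assumes "n \<ge> 1"
  shows "(\<forall>k. card {w \<in> linear_extensions n (relabel (eps n) (zigzag n)). des n w = k}
              = card {u \<in> up_down n. big_returns n u = k})
       \<and> zigzag_eulerian n = (\<Sum>u\<in>up_down n. monom 1 (1 + big_returns n u))"
proof (intro conjI allI)
  let ?f = "\<lambda>u. eps n \<circ> inv u"
  let ?L = "linear_extensions n (relabel (eps n) (zigzag n))"
  note bij = bij_betw_up_down_linear_extensions[of n]
  show "card {w \<in> ?L. des n w = k} = card {u \<in> up_down n. big_returns n u = k}" for k
  proof -
    have "bij_betw ?f {u \<in> up_down n. big_returns n u = k} {w \<in> ?L. des n w = k}"
    proof (rule bij_betw_subset[OF bij])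
      \<comment> \<open>Writing \<open>?L\<close> as an image presents each \<open>w\<close> as
        \<open>?f u\<close>, so that \<open>des_eps_comp_inv\<close> applies.\<close>
      have "{w \<in> ?f ` up_down n. des n w = k} = ?f ` {u \<in> up_down n. big_returns n u = k}"
        by (auto simp: des_eps_comp_inv)
      then show "?f ` {u \<in> up_down n. big_returns n u = k} = {w \<in> ?L. des n w = k}"
        by (simp only: bij_betw_imp_surj_on[OF bij])
    qed auto
    then show ?thesis
      by (rule bij_betw_same_card[symmetric])
  qed
  have "zigzag_eulerian n = (\<Sum>u\<in>up_down n. monom 1 (1 + des n (?f u)))"
    unfolding zigzag_eulerian_def by (rule sum.reindex_bij_betw[OF bij, symmetric])
  then show "zigzag_eulerian n = (\<Sum>u\<in>up_down n. monom 1 (1 + big_returns n u))"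
    by (simp add: des_eps_comp_inv cong: sum.cong)
qed

end
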